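(* For all integers $k\ge 1$, $n\ge 0$ and all $$(a,b,c)\in\{(1,3,4),(1,3,5),(1,4,5),(1,5,7)\},$$ we have $\gamma_{a,b,c,2,1}^k(n)\ge 0$; that is, the coefficient of $q^n$ in $$\frac{1}{(1-q^a)(1-q^b)(1-q^c)}\sum_{j\notin[-k,k-1]}(-1)^{j+k}q^{2j^2+j}$$ is nonnegative.
   Context: Identities are between formal power series in $q$. The sum $\sum_{j\notin[-k,k-1]}$ is over all integers $j\le -k-1$ and all integers $j\ge k$. In general $\gamma_{a,b,c,A,B}^k(n)$ is defined by $\frac{1}{(1-q^a)(1-q^b)(1-q^c)}\sum_{j\notin[-k,k-1]}(-1)^{j+k}q^{Aj^2+Bj}=\sum_{n\ge0}\gamma_{a,b,c,A,B}^k(n)q^n$. *)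

theory Defs
  imports "HOL-Analysis.Analysis"
begin

text \<open>
  The infinite sum is taken in the \<open>X\<close>-adic topology of the library's formal power series.
  Its exponents \<open>A j\<^sup>2 + B j\<close> are understood to be nonnegative (\<open>nat\<close> would truncate
  negative ones), and for \<open>A > 0\<close> the sum converges, see \<open>outer_theta_has_sum\<close> below.
  The coefficients are real only because division of power series needs a field.
\<close>

definition outer_theta :: "int \<Rightarrow> int \<Rightarrow> int \<Rightarrow> real fps" where
  "outer_theta A B k =
     (\<Sum>\<^sub>\<infinity>j\<in>- {-k..k-1}. fps_const ((-1) powi (j + k)) * fps_X ^ nat (A * j\<^sup>2 + B * j))"

definition gamma_coeff ::
  "nat \<Rightarrow> nat \<Rightarrow> nat \<Rightarrow> int \<Rightarrow> int \<Rightarrow> int \<Rightarrow> nat \<Rightarrow> real" where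
  "gamma_coeff a b c A B k n =
     fps_nth (1 / ((1 - fps_X ^ a) * (1 - fps_X ^ b) * (1 - fps_X ^ c)) * outer_theta A B k) n"

lemma finite_exponent_le:
  fixes A B :: int
  assumes "A > 0"
  shows "finite {j. nat (A * j\<^sup>2 + B * j) \<le> N}"
proof (rule finite_subset)
  show "{j. nat (A * j\<^sup>2 + B * j) \<le> N} \<subseteq> {- (\<bar>B\<bar> + int N) .. \<bar>B\<bar> + int N}"
  proof
    fix j assume "j \<in> {j. nat (A * j\<^sup>2 + B * j) \<le> N}"
    hence le: "A * j\<^sup>2 + B * j \<le> int N" by auto
    have "\<bar>j\<bar> \<le> \<bar>B\<bar> + int N"
    proof (rule ccontr)
      assume "\<not> ?thesis"
      hence gt: "\<bar>j\<bar> - \<bar>B\<bar> \<ge> int N + 1" by simp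
      have "int N + 1 \<le> \<bar>j\<bar> * (\<bar>j\<bar> - \<bar>B\<bar>)"
        using mult_mono[of 1 "\<bar>j\<bar>" "int N + 1" "\<bar>j\<bar> - \<bar>B\<bar>"] gt by simp
      also have "\<dots> = j\<^sup>2 - \<bar>B * j\<bar>"
        by (simp add: algebra_simps abs_mult power2_eq_square)
      also have "\<dots> \<le> A * j\<^sup>2 + B * j"
        using mult_right_mono[of 1 A "j\<^sup>2"] assms by simp
      finally show False using le by simp
    qed
    thus "j \<in> {- (\<bar>B\<bar> + int N) .. \<bar>B\<bar> + int N}" by auto
  qed
qed simp

lemma outer_theta_has_sum:
  fixes A B k :: int
  assumes "A > 0"
  defines "S \<equiv> (Abs_fps (\<lambda>n. \<Sum>j | j \<notin> {-k..k-1} \<and> 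
      nat (A * j\<^sup>2 + B * j) = n. (-1) powi (j + k)) :: real fps)"
  shows "((\<lambda>j. fps_const ((-1) powi (j + k)) * fps_X ^ nat (A * j\<^sup>2 + B * j)) has_sum S)
           (- {-k..k-1})"
  unfolding has_sum_def
proof (rule tendsto_fpsI)
  fix n
  let ?e = "\<lambda>j. nat (A * j\<^sup>2 + B * j)"
  let ?E = "{j. j \<notin> {-k..k-1} \<and> ?e j = n}"
  let ?f = "\<lambda>j. fps_const ((-1) powi (j + k)) * fps_X ^ ?e j :: real fps"
  have fin: "finite ?E"
    by (rule finite_subset[OF _ finite_exponent_le[OF assms(1), of B n]]) auto
  show "\<forall>\<^sub>F F in finite_subsets_at_top (- {-k..k-1}). fps_nth (sum ?f F) n = fps_nth S n"
    unfolding eventually_finite_subsets_at_top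
  proof (intro exI[of _ ?E] conjI allI impI)
    fix F assume F: "finite F \<and> ?E \<subseteq> F \<and> F \<subseteq> - {-k..k-1}"
    have "fps_nth (sum ?f F) n = (\<Sum>j\<in>F. if ?e j = n then (-1) powi (j + k) else 0)"
      unfolding fps_sum_nth by (intro sum.cong) auto
    also have "\<dots> = (\<Sum>j\<in>?E. (-1) powi (j + k))"
      using F by (intro sum.mono_neutral_cong_right) auto
    finally show "fps_nth (sum ?f F) n = fps_nth S n" by (simp add: S_def)
  qed (use fin in auto)
qed

lemma outer_theta_nth:
  assumes "A > 0"
  shows "fps_nth (outer_theta A B k) n =
           (\<Sum>j | j \<notin> {-k..k-1} \<and> nat (A * j\<^sup>2 + B * j) = n. (-1) powi (j + k))"
  unfolding outer_theta_def infsumI[OF outer_theta_has_sum[OF assms]] by simp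

end

theory Submission
  imports Defs
begin

text \<open>
  The exponents \<open>2 j\<^sup>2 + j\<close> are the triangular numbers \<open>T\<^sub>m\<close> (\<open>m = 2 j\<close> or \<open>m = - 2 j - 1\<close>), and the sign
  \<open>(-1)\<^sup>j\<close> is the parity of \<open>T\<^sub>m\<close>. Hence the coefficient is \<open>\<Sum> (-1)\<^bsup>k + T\<^sub>m\<^esup> p (n - T\<^sub>m)\<close> over
  \<open>m \<ge> 2 k\<close> with \<open>T\<^sub>m \<le> n\<close>, where \<open>p\<close> counts partitions into the parts \<open>1, b, c\<close>. Let \<open>M\<close> be the last index.
  If \<open>M \<le> 2 k + 1\<close>, monotonicity of \<open>p\<close> suffices. Otherwise write \<open>p\<close> as a square \<open>(n + s/2)\<^sup>2\<close> divided
  by \<open>2 b c\<close>, with \<open>s = 1 + b + c\<close>, plus a constant, plus terms periodic modulo \<open>b\<close> and modulo \<open>c\<close>.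
  The alternating sum of the squares telescopes to a closed form that grows like \<open>M\<^sup>2\<close>, while the alternating
  sums of the periodic terms are themselves periodic, hence bounded, up to a drift linear in \<open>M\<close> that only a
  table of length 4 produces. The remaining \<open>n\<close>, at most \<open>464\<close>, are checked by evaluation.
\<close>

subsection \<open>Triangular exponents\<close>

primrec tri :: "nat \<Rightarrow> nat" where
  "tri 0 = 0"
| "tri (Suc m) = tri m + Suc m"

lemma double_tri: "2 * tri m = m * (m + 1)"
  by (induction m) auto

lemma of_nat_tri: "(of_nat (tri m) :: 'a :: field_char_0) = of_nat m * (of_nat m + 1) / 2"
  by (induction m) (auto simp: field_simps)

lemma tri_even: "tri (2 * i) = i * (2 * i + 1)"
  using double_tri[of "2 * i"] by simp

lemma tri_odd: "tri (2 * i + 1) = (i + 1) * (2 * i + 1)"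
  using double_tri[of "2 * i + 1"] by simp

lemma strict_mono_tri: "strict_mono tri"
  by (rule strict_monoI_Suc) simp

lemma tri_le_iff [simp]: "tri i \<le> tri j \<longleftrightarrow> i \<le> j"
  using strict_mono_less_eq[OF strict_mono_tri] .

lemma tri_less_iff [simp]: "tri i < tri j \<longleftrightarrow> i < j"
  using strict_mono_less[OF strict_mono_tri] .

lemma le_tri: "m \<le> tri m"
  by (induction m) auto

lemma finite_tri_le [simp]: "finite {m. P m \<and> tri m \<le> n}"
  by (rule finite_subset[of _ "{..n}"]) (auto intro: order_trans[OF le_tri])

lemma ex_tri_bracket: "\<exists>M. tri M \<le> n \<and> n < tri (Suc M)"
proof -
  have "\<exists>M. n < tri (Suc M)"
    using le_tri[of "Suc n"] by (auto intro!: exI[of _ n])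
  moreover define M where "M = (LEAST M. n < tri (Suc M))"
  ultimately have "n < tri (Suc M)" by (metis LeastI)
  moreover have "tri M \<le> n"
  proof (cases M)
    case (Suc M')
    hence "\<not> n < tri (Suc M')" unfolding M_def using not_less_Least by (metis lessI)
    thus ?thesis using Suc by simp
  qed simp
  ultimately show ?thesis by blast
qed

lemma tri_le_bracket:
  assumes "tri M \<le> n" "n < tri (Suc M)"
  shows "tri m \<le> n \<longleftrightarrow> m \<le> M"
proof
  assume "tri m \<le> n"
  hence "tri m < tri (Suc M)" using assms by linarith
  thus "m \<le> M" unfolding tri_less_iff by simp
next
  assume "m \<le> M"
  hence "tri m \<le> tri M" by simp
  thus "tri m \<le> n" using assms by linarith
qed

lemma sign_tri_even: "(-1 :: 'a :: ring_1) ^ tri (2 * i) = (-1) ^ i"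
  unfolding tri_even by (simp add: power_mult minus_one_power_iff)

lemma sign_tri_odd: "(-1 :: 'a :: ring_1) ^ tri (2 * i + 1) = - ((-1) ^ i)"
  unfolding tri_odd by (simp add: minus_one_power_iff)

section \<open>Theta coefficients over triangular numbers\<close>

lemma outer_theta_nth_tri:
  "fps_nth (outer_theta 2 1 (int k)) N = (\<Sum>m | 2 * k \<le> m \<and> tri m = N. (-1) ^ (k + N))"
  unfolding outer_theta_nth[of 2, simplified]
\<comment> \<open>Even \<open>m = 2 * j\<close> covers \<open>j \<ge> k\<close> and odd
  \<open>m = - 2 * j - 1\<close> covers \<open>j \<le> - k - 1\<close>, so the two-sided range
  becomes the single ray \<open>m \<ge> 2 * k\<close>.\<close>
proof (rule sum.reindex_bij_witness[
      where i = "\<lambda>m. if even m then int (m div 2) else - int (m div 2) - 1"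
        and j = "\<lambda>j. if j \<ge> 0 then 2 * nat j else 2 * nat (- j - 1) + 1"], goal_cases)
  case (1 j)
  thus ?case by (auto simp: nat_mult_distrib)
next
  case (2 j)
  show ?case
  proof (cases "j \<ge> 0")
    case True
    then obtain i where i: "j = int i" using nonneg_int_cases by blast
    have "2 * j\<^sup>2 + j = int (tri (2 * i))"
      unfolding i tri_even by (simp add: power2_eq_square algebra_simps)
    thus ?thesis using 2 i by auto
  next
    case False
    define i where "i = nat (- j - 1)"
    have i: "j = - int i - 1" using False by (simp add: i_def)
    have "2 * j\<^sup>2 + j = int (tri (2 * i + 1))"
      unfolding i tri_odd by (simp add: power2_eq_square algebra_simps)
    thus ?thesis using 2 False i by (auto simp del: tri.simps)
  qed
next
  case (3 m)
  thus ?case by (auto elim!: evenE oddE)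
next
  case (4 m)
  show ?case
  proof (cases "even m")
    case True
    then obtain i where i: "m = 2 * i" by (elim evenE)
    have "2 * (int i)\<^sup>2 + int i = int (tri m)"
      unfolding i tri_even by (simp add: power2_eq_square algebra_simps)
    thus ?thesis using 4 i by auto
  next
    case False
    then obtain i where i: "m = 2 * i + 1" by (elim oddE)
    have "2 * (- int i - 1)\<^sup>2 + (- int i - 1) = int (tri m)"
      unfolding i tri_odd by (simp add: power2_eq_square algebra_simps)
    thus ?thesis using 4 i by (auto simp del: tri.simps)
  qed
next
  case (5 j)
  hence N: "N = nat (2 * j\<^sup>2 + j)" by auto
  have "2 * j\<^sup>2 + j \<ge> 0"
  proof (cases "j \<ge> 0")
    case False
    hence "(- j) * (-(2 * j + 1)) \<ge> 0" by (intro mult_nonneg_nonneg) auto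
    thus ?thesis by (simp add: power2_eq_square algebra_simps)
  qed simp
  hence "even N \<longleftrightarrow> even j" unfolding N by (auto simp: even_nat_iff)
  thus ?case by (auto simp: minus_one_power_iff power_int_def even_nat_iff)
qed

lemma gamma_coeff_eq:
  "gamma_coeff a b c 2 1 (int k) n =
     (\<Sum>m | 2 * k \<le> m \<and> tri m \<le> n. (-1) ^ (k + tri m) *
        fps_nth (1 / ((1 - fps_X ^ a) * (1 - fps_X ^ b) * (1 - fps_X ^ c))) (n - tri m))"
proof -
  define f :: "real fps" where "f = 1 / ((1 - fps_X ^ a) * (1 - fps_X ^ b) * (1 - fps_X ^ c))"
  let ?g = "\<lambda>m. (-1) ^ (k + tri m) * fps_nth f (n - tri m)"
  let ?A = "{m. 2 * k \<le> m \<and> tri m \<le> n}"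
  have "gamma_coeff a b c 2 1 (int k) n = fps_nth (outer_theta 2 1 (int k) * f) n"
    unfolding gamma_coeff_def f_def by (simp add: mult.commute)
  also have "\<dots> = (\<Sum>N=0..n. \<Sum>m | 2 * k \<le> m \<and> tri m = N. ?g m)"
    unfolding fps_mult_nth outer_theta_nth_tri sum_distrib_right by (intro sum.cong) auto
  also have "\<dots> = (\<Sum>N=0..n. \<Sum>m | m \<in> ?A \<and> tri m = N. ?g m)"
    by (intro sum.cong) auto
  also have "\<dots> = sum ?g ?A"
    by (rule sum.group) auto
  finally show ?thesis unfolding f_def .
qed

subsection \<open>Partitions into three parts and the quadratic main term\<close>

lemma fps_nth_divide_nonneg:
  fixes f :: "real fps"
  assumes "b > 0" "\<And>n. 0 \<le> fps_nth f n"
  shows "0 \<le> fps_nth (f / (1 - fps_X ^ b)) n"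
proof -
  define g where "g = f / (1 - fps_X ^ b)"
  have nth0: "fps_nth (1 - fps_X ^ b :: real fps) 0 \<noteq> 0" using assms(1) by simp
  hence "is_unit (1 - fps_X ^ b :: real fps)" by simp
  hence "f = g * (1 - fps_X ^ b)"
    unfolding g_def by (simp add: unit_imp_dvd)
  hence "f = g - fps_X ^ b * g" by (simp add: algebra_simps)
  hence rec: "fps_nth g n = fps_nth f n + (if n < b then 0 else fps_nth g (n - b))" for n
    by (simp add: fps_X_power_mult_nth)
  have "0 \<le> fps_nth g n"
  proof (induction n rule: less_induct)
    case (less n)
    show ?case using assms less.IH[of "n - b"] by (subst rec) auto
  qed
  thus ?thesis unfolding g_def .
qed

text \<open>Dividing by \<open>1 - fps_X\<close> turns coefficients into partial sums, and the other
  two factors already give a quotient with nonnegative coefficients.\<close>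

lemma fps_nth_recip3_mono:
  assumes "b > 0" "c > 0"
  shows "mono (fps_nth (1 / ((1 - fps_X) * (1 - fps_X ^ b) * (1 - fps_X ^ c)) :: real fps))"
    and "0 \<le> fps_nth (1 / ((1 - fps_X) * (1 - fps_X ^ b) * (1 - fps_X ^ c)) :: real fps) n"
proof -
  let ?d = "(1 - fps_X ^ b) * (1 - fps_X ^ c) :: real fps"
  define f :: "real fps" where "f = 1 / ((1 - fps_X) * (1 - fps_X ^ b) * (1 - fps_X ^ c))"
  define g :: "real fps" where "g = 1 / ?d"
  have g: "0 \<le> fps_nth g n" for n
  proof -
    have "g = (1 / (1 - fps_X ^ b)) / (1 - fps_X ^ c)"
      unfolding g_def using assms by (intro is_unit_div_mult2_eq) auto
    thus ?thesis using assms by (auto intro!: fps_nth_divide_nonneg)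
  qed
  have unit: "is_unit (1 - fps_X :: real fps)" "is_unit ?d"
    using assms by auto
  have "f = g / (1 - fps_X)"
    unfolding f_def g_def using unit is_unit_div_mult2_eq[of ?d "1 - fps_X" 1]
    by (simp add: ac_simps)
  hence "g = f * (1 - fps_X)" using unit by (simp add: unit_imp_dvd)
  hence "g = f - fps_X * f" by (simp add: algebra_simps)
  hence step: "fps_nth f (Suc n) = fps_nth f n + fps_nth g (Suc n)" for n by simp
  show "mono (fps_nth (1 / ((1 - fps_X) * (1 - fps_X ^ b) * (1 - fps_X ^ c)) :: real fps))" 
    unfolding f_def[symmetric] by (rule incseq_SucI) (use step g in simp)
  have "f = g / (1 - fps_X ^ 1)" by (simp add: \<open>f = g / (1 - fps_X)\<close>)
  thus "0 \<le> fps_nth (1 / ((1 - fps_X) * (1 - fps_X ^ b) * (1 - fps_X ^ c)) :: real fps) n"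
    unfolding f_def[symmetric] using fps_nth_divide_nonneg[of 1 g n] g by simp
qed

text \<open>The zeros of \<open>P\<close> at negative arguments let its recurrence absorb the truncation at 0.\<close>
lemma fps_nth_recip3:
  fixes P :: "int \<Rightarrow> real" and b c n :: nat
  assumes rec: "\<And>n. P n - P (n - 1) - P (n - b) - P (n - c) + P (n - 1 - b) + P (n - 1 - c)
                    + P (n - b - c) - P (n - 1 - b - c) = 0"
    and zero: "\<And>n. - int (b + c) \<le> n \<Longrightarrow> n < 0 \<Longrightarrow> P n = 0"
    and "P 0 = 1" "b > 0" "c > 0"
  shows "fps_nth (1 / ((1 - fps_X) * (1 - fps_X ^ b) * (1 - fps_X ^ c))) n = P n"
proof -
  define F where "F = Abs_fps (\<lambda>n. P (int n))"
  let ?d = "(1 - fps_X) * (1 - fps_X ^ b) * (1 - fps_X ^ c) :: real fps"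
  \<comment> \<open>The case \<open>n = 0\<close> is excluded: there the largest shift reaches
    \<open>- (1 + b + c)\<close>, just outside the range of zeros, where the recurrence forces the
    value 1.\<close>
  have shift: "fps_nth (fps_X ^ i * F) n = P (int n - int i)" if "n > 0" "i \<le> 1 + b + c" for n i
    using that zero[of "int n - int i"] by (auto simp: fps_X_power_mult_nth F_def of_nat_diff)
  have "F * ?d = 1"
  proof (rule fps_ext)
    fix n
    have eq: "F * ?d = F - fps_X ^ 1 * F - fps_X ^ b * F - fps_X ^ c * F + fps_X ^ (1 + b) * F
        + fps_X ^ (1 + c) * F + fps_X ^ (b + c) * F - fps_X ^ (1 + b + c) * F"
      by (simp add: algebra_simps power_add)
    show "fps_nth (F * ?d) n = fps_nth 1 n"
    proof (cases "n = 0")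
      case True
      thus ?thesis unfolding eq using assms by (simp add: fps_X_power_mult_nth F_def)
    next
      case False
      have "fps_nth F n = P (int n)" by (simp add: F_def)
      thus ?thesis unfolding eq fps_sub_nth fps_add_nth using False rec[of "int n"]
        by (simp only: shift fps_one_nth) (simp add: algebra_simps)
    qed
  qed
  hence "1 / ?d = F" by (metis nonzero_mult_div_cancel_right mult_zero_right zero_neq_one)
  thus ?thesis by (simp add: F_def)
qed

section \<open>Alternating sums of shifted squares\<close>

lemma alternating_square_sum:
  fixes y :: real
  shows "(\<Sum>m<2 * i. (-1) ^ tri m * (y - tri m)\<^sup>2) = - ((-1) ^ i * (i * (2 * y - 4 * i\<^sup>2 + 3)))"
proof (induction i)
  case (Suc i)
  \<comment> \<open>The indices \<open>2 * i\<close> and \<open>2 * i + 1\<close> carry opposite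
    signs, so \<open>y\<^sup>2\<close> cancels within each pair and the pair is linear in
    \<open>y\<close>.\<close>
  have "{..<2 * Suc i} = insert (2 * i) (insert (2 * i + 1) {..<2 * i})" by auto
  hence "(\<Sum>m<2 * Suc i. (-1) ^ tri m * (y - tri m)\<^sup>2) =
     (-1) ^ tri (2 * i) * (y - tri (2 * i))\<^sup>2 + (-1) ^ tri (2 * i + 1) * (y - tri (2 * i + 1))\<^sup>2 +
     (\<Sum>m<2 * i. (-1) ^ tri m * (y - tri m)\<^sup>2)" by simp
  also have "\<dots> = (-1) ^ i * ((y - tri (2 * i))\<^sup>2 - (y - tri (2 * i + 1))\<^sup>2 - i * (2 * y - 4 * i\<^sup>2 + 3))"
    unfolding Suc.IH sign_tri_even sign_tri_odd by (simp add: algebra_simps)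
  also have "(y - tri (2 * i))\<^sup>2 - (y - tri (2 * i + 1))\<^sup>2 - i * (2 * y - 4 * i\<^sup>2 + 3) =
      Suc i * (2 * y - 4 * (Suc i)\<^sup>2 + 3)"
    unfolding of_nat_tri by (simp add: field_simps power2_eq_square)
  finally show ?case by simp
qed simp

text \<open>The term \<open>2 * y - 1\<close> is the closed form at \<open>i = 1\<close>, the least
  that the removed head contributes in \<open>alternating_square_tail_bound\<close>; the amount
  subtracted from it is the surplus left to absorb errors. The cap 13 on \<open>s\<close> is 1 + 5 +
  7, from the largest triple.\<close>

lemma alternating_square_sum_bound:
  fixes s y :: real and M n :: nat
  assumes s: "0 \<le> s" "s \<le> 13" and M: "22 \<le> M" "tri M \<le> n" "n < tri (Suc M)"
  defines "y \<equiv> n + s / 2"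
  shows "\<bar>\<Sum>m<Suc M. (-1) ^ tri m * (y - tri m)\<^sup>2\<bar> \<le> 2 * y - 1 - ((real M)\<^sup>2 / 4 + M / 2 - 2)"
proof -
  define t where "t = real n - tri M"
  have "n \<le> tri M + M" using M by simp
  hence "real n \<le> tri M + M" by (metis of_nat_add of_nat_le_iff)
  hence t: "0 \<le> t" "t \<le> M" using M unfolding t_def by simp_all
  show ?thesis
  proof (cases "even M")
    case True
    then obtain i where i: "M = 2 * i" by (elim evenE)
    have i11: "real i \<ge> 11" using M i by simp
    define \<tau> where "\<tau> = t + s / 2"
    have y: "y = i * (2 * i + 1) + \<tau>"
      unfolding y_def \<tau>_def t_def i tri_even by simp
    have y': "y - tri M = \<tau>" unfolding y_def \<tau>_def t_def by simp
    have \<tau>: "0 \<le> \<tau>" "\<tau> \<le> 3 * i" using s t i11 unfolding \<tau>_def i by auto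
    have "(\<Sum>m<Suc M. (-1) ^ tri m * (y - tri m)\<^sup>2) = (-1) ^ i * (\<tau>\<^sup>2 - i * (2 * y - 4 * i\<^sup>2 + 3))"
      unfolding sum.lessThan_Suc y' unfolding i alternating_square_sum sign_tri_even
      by (simp add: algebra_simps)
    also have "\<bar>\<dots>\<bar> = \<bar>\<tau>\<^sup>2 - i * (2 * y - 4 * i\<^sup>2 + 3)\<bar>" by (simp add: abs_mult power_abs)
    also have "\<dots> \<le> 2 * y - 1 - ((real M)\<^sup>2 / 4 + M / 2 - 2)"
    proof (rule abs_leI)
      have "0 \<le> (\<tau> + i) * (3 * i - \<tau>) + 2 * i\<^sup>2"
        using \<tau> by (auto intro!: add_nonneg_nonneg mult_nonneg_nonneg)
      thus "\<tau>\<^sup>2 - i * (2 * y - 4 * i\<^sup>2 + 3) \<le> 2 * y - 1 - ((real M)\<^sup>2 / 4 + M / 2 - 2)"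
        using \<tau> i11 unfolding y i by (simp add: power2_eq_square algebra_simps)
      \<comment> \<open>This square is exactly the difference of the two sides below, so for even
        \<open>M\<close> no larger surplus would follow for all \<open>\<tau>\<close>.\<close>
      have "0 \<le> (\<tau> - i + 1)\<^sup>2" by simp
      thus "- (\<tau>\<^sup>2 - i * (2 * y - 4 * i\<^sup>2 + 3)) \<le> 2 * y - 1 - ((real M)\<^sup>2 / 4 + M / 2 - 2)"
        unfolding y i by (simp add: power2_eq_square algebra_simps)
    qed
    finally show ?thesis .
  next
    case False
    then obtain j where j: "M = 2 * j + 1" by (elim oddE)
    define i where "i = Suc j"
    have i: "Suc M = 2 * i" "real M = 2 * real i - 1" unfolding j i_def by simp_all
    have i12: "real i \<ge> 12" using M i by simp
    have y: "2 * y = 2 * (real i * (2 * real i - 1)) + 2 * t + s"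
      unfolding y_def t_def of_nat_tri i by (simp add: field_simps)
    have "(\<Sum>m<Suc M. (-1) ^ tri m * (y - tri m)\<^sup>2) = - ((-1) ^ i * (i * (2 * y - 4 * i\<^sup>2 + 3)))"
      unfolding i alternating_square_sum by simp
    also have "\<bar>\<dots>\<bar> = \<bar>i * (2 * y - 4 * i\<^sup>2 + 3)\<bar>" by (simp add: abs_mult power_abs)
    also have "\<dots> \<le> 2 * y - 1 - ((real M)\<^sup>2 / 4 + M / 2 - 2)"
    proof (rule abs_leI)
      \<comment> \<open>From \<open>t \<le> 2 * i - 1\<close> and \<open>s \<le> 13\<close> the
        second factor is at least \<open>i - 11\<close>; this is where \<open>M\<close> must be
        large.\<close>
      have "0 \<le> (real i - 1) * (5 * i - 2 * t - s)"
        using t i i12 s by (intro mult_nonneg_nonneg) auto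
      thus "i * (2 * y - 4 * i\<^sup>2 + 3) \<le> 2 * y - 1 - ((real M)\<^sup>2 / 4 + M / 2 - 2)"
        unfolding y i by (simp add: power2_eq_square field_simps)
      have "0 \<le> i * t" "0 \<le> i * s" "0 \<le> real i * i" using t s by auto
      thus "- (i * (2 * y - 4 * i\<^sup>2 + 3)) \<le> 2 * y - 1 - ((real M)\<^sup>2 / 4 + M / 2 - 2)"
        using t s i12 unfolding y i by (simp add: power2_eq_square field_simps)
    qed
    finally show ?thesis .
  qed
qed

text \<open>The tail is the full sum minus the head of \<open>2 * k\<close> terms. After
  multiplication by \<open>(-1) ^ k\<close> the head has a known sign, and its contribution beats
  the absolute value of the full sum.\<close>

lemma alternating_square_tail_bound:
  fixes s y :: real and M n k :: nat
  assumes s: "0 \<le> s" "s \<le> 13" and M: "22 \<le> M" "tri M \<le> n" "n < tri (Suc M)"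
    and k: "1 \<le> k" "2 * k + 2 \<le> M"
  defines "y \<equiv> n + s / 2"
  shows "(real M)\<^sup>2 / 4 + M / 2 - 2 \<le> (\<Sum>m=2*k..M. (-1) ^ (k + tri m) * (y - tri m)\<^sup>2)"
proof -
  let ?f = "\<lambda>m. (-1) ^ tri m * (y - tri m)\<^sup>2"
  have "{2*k..M} = {2*k..<Suc M}" by auto
  hence "(\<Sum>m=2*k..M. (-1) ^ (k + tri m) * (y - tri m)\<^sup>2) =
      (-1) ^ k * (sum ?f {..<Suc M} - sum ?f {..<2 * k})"
    using sum_diff_nat_ivl[of 0 "2 * k" "Suc M" ?f] k
    by (simp add: sum_distrib_left power_add atLeast0LessThan algebra_simps)
  also have "\<dots> = (-1) ^ k * sum ?f {..<Suc M} + k * (2 * y - 4 * k\<^sup>2 + 3)"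
    unfolding alternating_square_sum by (simp add: algebra_simps flip: power_mult_distrib)
  also have "\<dots> \<ge> - \<bar>sum ?f {..<Suc M}\<bar> + (2 * y - 1)"
  proof (rule add_mono)
    have "\<bar>(-1) ^ k * sum ?f {..<Suc M}\<bar> = \<bar>sum ?f {..<Suc M}\<bar>" 
      unfolding abs_mult by (simp add: power_abs)
    thus "- \<bar>sum ?f {..<Suc M}\<bar> \<le> (-1) ^ k * sum ?f {..<Suc M}" by linarith
    have "tri (2 * (k + 1)) \<le> tri M" unfolding tri_le_iff using k by simp
    hence "(k + 1) * (2 * (k + 1) + 1) \<le> n" using M tri_even[of "k + 1"] by simp
    hence "real ((k + 1) * (2 * (k + 1) + 1)) \<le> real n" by (simp only: of_nat_le_iff)
    hence "0 \<le> 2 * y - (2 * k + 1)\<^sup>2"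
      using s by (simp add: y_def power2_eq_square algebra_simps)
    \<comment> \<open>This product is exactly
      \<open>k * (2 * y - 4 * k\<^sup>2 + 3) - (2 * y - 1)\<close>.\<close>
    hence "0 \<le> (real k - 1) * (2 * y - (2 * k + 1)\<^sup>2)"
      using k by (intro mult_nonneg_nonneg) auto
    thus "2 * y - 1 \<le> k * (2 * y - 4 * k\<^sup>2 + 3)"
      by (simp add: power2_eq_square algebra_simps)
  qed
  finally show ?thesis
    using alternating_square_sum_bound[OF s M] unfolding y_def by linarith
qed

subsection \<open>Evaluation of small cases\<close>

text \<open>The ring is left open: monotonicity is applied to the real coefficients, evaluation to
  their integer multiples.\<close>

definition tail_sum :: "(nat \<Rightarrow> 'a :: comm_ring_1) \<Rightarrow> nat \<Rightarrow> nat \<Rightarrow> 'a" where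
  "tail_sum p k n = (\<Sum>m | 2 * k \<le> m \<and> tri m \<le> n. (-1) ^ (k + tri m) * p (n - tri m))"

lemma tail_sum_bracket:
  assumes "tri M \<le> n" "n < tri (Suc M)"
  shows "tail_sum p k n = (\<Sum>m=2*k..M. (-1) ^ (k + tri m) * p (n - tri m))"
  unfolding tail_sum_def tri_le_bracket[OF assms] by (intro sum.cong) auto

text \<open>The factor \<open>(-1) ^ k\<close> makes index \<open>2 * k\<close> enter with plus and
  \<open>2 * k + 1\<close> with minus; passing to \<open>Suc k\<close> flips all remaining
  signs.\<close>

lemma tail_sum_rec:
  "tail_sum p k n = (if tri (2 * k) \<le> n then p (n - tri (2 * k)) else 0)
     - (if tri (2 * k + 1) \<le> n then p (n - tri (2 * k + 1)) else 0) - tail_sum p (Suc k) n"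
proof -
  let ?f = "\<lambda>m. (-1) ^ (k + tri m) * p (n - tri m)"
  let ?A = "{m. m = 2 * k \<and> tri m \<le> n}" and ?B = "{m. m = 2 * k + 1 \<and> tri m \<le> n}"
    and ?C = "{m. 2 * Suc k \<le> m \<and> tri m \<le> n}"
  have "{m. 2 * k \<le> m \<and> tri m \<le> n} = ?A \<union> (?B \<union> ?C)" by auto
  hence "tail_sum p k n = sum ?f ?A + (sum ?f ?B + sum ?f ?C)"
    unfolding tail_sum_def by (simp only:) (subst sum.union_disjoint, auto)+
  moreover have "sum ?f ?A = (if tri (2 * k) \<le> n then p (n - tri (2 * k)) else 0)"
  proof -
    have "?A = (if tri (2 * k) \<le> n then {2 * k} else {})" by auto
    thus ?thesis by (simp add: power_add sign_tri_even flip: power_mult_distrib)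
  qed
  moreover have "sum ?f ?B = - (if tri (2 * k + 1) \<le> n then p (n - tri (2 * k + 1)) else 0)"
  proof -
    have "?B = (if tri (2 * k + 1) \<le> n then {2 * k + 1} else {})" by auto
    thus ?thesis
      using sign_tri_odd[of k, where 'a = 'a]
      by (simp add: power_add del: tri.simps flip: power_mult_distrib)
  qed
  moreover have "sum ?f ?C = - tail_sum p (Suc k) n"
    unfolding tail_sum_def by (simp add: sum_negf)
  ultimately show ?thesis by simp
qed

lemma tail_sum_eq_0: "n < tri (2 * k) \<Longrightarrow> tail_sum p k n = 0"
proof -
  assume "n < tri (2 * k)"
  hence "\<not> tri m \<le> n" if "2 * k \<le> m" for m
    using that tri_le_iff[of "2 * k" m] by linarith
  hence "{m. 2 * k \<le> m \<and> tri m \<le> n} = {}" by auto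
  thus ?thesis unfolding tail_sum_def by (simp only: sum.empty)
qed

lemma tail_sum_nonneg_of_mono:
  fixes p :: "nat \<Rightarrow> 'a :: linordered_idom"
  assumes "mono p" "\<And>n. 0 \<le> p n" "n < tri (2 * Suc k)"
  shows "0 \<le> tail_sum p k n"
  using assms(2) monoD[OF assms(1), of "n - tri (2 * k + 1)" "n - tri (2 * k)"]
  by (subst tail_sum_rec) (simp add: tail_sum_eq_0[OF assms(3)])

fun subtract_at :: "nat \<Rightarrow> int list \<Rightarrow> int list \<Rightarrow> int list" where
  "subtract_at d [] ys = []"
| "subtract_at (Suc d) (x # xs) ys = x # subtract_at d xs ys"
| "subtract_at 0 xs [] = xs"
| "subtract_at 0 (x # xs) (y # ys) = (x - y) # subtract_at 0 xs ys"

lemma length_subtract_at [simp]: "length (subtract_at d xs ys) = length xs"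
  by (induction d xs ys rule: subtract_at.induct) auto

lemma nth_subtract_at:
  "i < length xs \<Longrightarrow> subtract_at d xs ys ! i =
     xs ! i - (if d \<le> i \<and> i - d < length ys then ys ! (i - d) else 0)"
proof (induction d xs ys arbitrary: i rule: subtract_at.induct)
  case (2 d x xs ys)
  thus ?case by (cases i) auto
next
  case (4 x xs y ys)
  thus ?case by (cases i) auto
qed auto

text \<open>Row \<open>k\<close> lists the tail sums at the arguments from \<open>tri (2 * k)\<close> on, below which they vanish;
  \<open>4 * k + 3\<close> and \<open>2 * k + 1\<close> are the distances from \<open>tri (2 * k)\<close> to \<open>tri (2 * k + 2)\<close> and
  \<open>tri (2 * k + 1)\<close>.\<close>
definition next_row :: "int list \<Rightarrow> nat \<Rightarrow> int list \<Rightarrow> int list" where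
  "next_row ps k h = (let q = take (4 * k + 3 + length h) ps
     in subtract_at (4 * k + 3) (subtract_at (2 * k + 1) q q) h)"

text \<open>Running \<open>k\<close> downwards lets each row be obtained from the one above it by
  list subtraction instead of summing afresh.\<close>

fun rows_nonneg :: "int list \<Rightarrow> nat \<Rightarrow> int list \<Rightarrow> bool" where
  "rows_nonneg ps 0 h = True"
| "rows_nonneg ps (Suc k) h =
     (let h' = next_row ps (Suc k) h in list_all (\<lambda>x. 0 \<le> x) h' \<and> rows_nonneg ps k h')"

lemma next_row_tail_sum:
  fixes p :: "nat \<Rightarrow> int"
  assumes "tri (2 * Suc k) \<le> N"
  defines "h \<equiv> \<lambda>q k. map (\<lambda>i. tail_sum q k (tri (2 * k) + i)) [0..<N - tri (2 * k)]"
  shows "next_row (map p [0..<N]) k (h p (Suc k)) = h p k"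
proof -
  have step: "tri (2 * Suc k) = tri (2 * k) + (4 * k + 3)" "tri (2 * k + 1) = tri (2 * k) + (2 * k + 1)"
    by simp_all
  have len: "length (h p (Suc k)) + (4 * k + 3) = N - tri (2 * k)"
    using assms(1) step unfolding h_def by simp
  have "next_row (map p [0..<N]) k (h p (Suc k)) ! i = h p k ! i" if i: "i < N - tri (2 * k)" for i
  proof -
    have "tri (2 * Suc k) + (i - (4 * k + 3)) = tri (2 * k) + i" if "4 * k + 3 \<le> i"
      using that step by simp
    moreover have "tail_sum p (Suc k) (tri (2 * k) + i) = 0" if "\<not> 4 * k + 3 \<le> i"
      by (rule tail_sum_eq_0) (use that step in simp)
    ultimately show ?thesis
      using i len step(1) tail_sum_rec[of p k "tri (2 * k) + i"] unfolding step(2)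
      by (auto simp: next_row_def Let_def nth_subtract_at add.commute h_def simp del: tri.simps)
  qed
  thus ?thesis
    using len by (intro nth_equalityI) (auto simp: next_row_def Let_def h_def)
qed

lemma rows_nonnegD:
  assumes "rows_nonneg (map p [0..<N]) k (map (\<lambda>i. tail_sum p (Suc k) (tri (2 * Suc k) + i)) [0..<N - tri (2 * Suc k)])"
    and "tri (2 * Suc k) \<le> N" "1 \<le> j" "j \<le> k" "n < N"
  shows "0 \<le> tail_sum p j n"
  using assms
proof (induction k)
  case (Suc k)
  let ?h = "map (\<lambda>i. tail_sum p (Suc k) (tri (2 * Suc k) + i)) [0..<N - tri (2 * Suc k)]"
  have "list_all (\<lambda>x. 0 \<le> x) ?h \<and> rows_nonneg (map p [0..<N]) k ?h"
    using Suc.prems(1) unfolding rows_nonneg.simps Let_def next_row_tail_sum[OF Suc.prems(2)] .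
  moreover have "tri (2 * Suc k) \<le> N"
    by (rule order_trans[OF _ Suc.prems(2)]) (unfold tri_le_iff, simp)
  moreover have "0 \<le> tail_sum p (Suc k) n" if "list_all (\<lambda>x. 0 \<le> x) ?h"
  proof (cases "n < tri (2 * Suc k)")
    case False
    hence "tail_sum p (Suc k) n = ?h ! (n - tri (2 * Suc k))" "n - tri (2 * Suc k) < length ?h"
      using Suc.prems(5) by (auto simp del: tri.simps)
    thus ?thesis using that list_all_length by metis
  qed (simp add: tail_sum_eq_0)
  ultimately show ?case using Suc.IH Suc.prems by (cases "j = Suc k") auto
qed simp

subsection \<open>Periodic terms\<close>

definition tab :: "int list \<Rightarrow> int \<Rightarrow> int" where
  "tab t n = t ! nat (n mod int (length t))"

lemma tab_cong: "n mod int (length t) = m mod int (length t) \<Longrightarrow> tab t n = tab t m"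
  by (simp add: tab_def)

lemma tab_minus_length [simp]: "tab t (n - int (length t)) = tab t n"
  by (rule tab_cong) simp

text \<open>\<open>quasi\<close> is an integer multiple of the coefficient of \<open>q\<^sup>n\<close> in
  \<open>1 / ((1 - q) (1 - q\<^sup>b) (1 - q\<^sup>c))\<close>, where \<open>b\<close> and \<open>c\<close> are the lengths of the tables, which
  hold the contributions of the nontrivial \<open>b\<close>-th and \<open>c\<close>-th roots of unity.\<close>
definition quasi :: "int \<Rightarrow> int \<Rightarrow> int \<Rightarrow> int list \<Rightarrow> int \<Rightarrow> int list \<Rightarrow> int \<Rightarrow> int" where
  "quasi w C u tb v tc n =
     w * (n * (n + 1 + int (length tb) + int (length tc))) + C + u * tab tb n + v * tab tc n"

text \<open>With E the backward shift this is (1 - E)(1 - E^b)(1 - E^c) applied to \<open>Q\<close>: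
  a third-order difference kills the quadratic, and 1 - E^b and 1 - E^c kill the respective
  tables.\<close>

lemma quasi_rec:
  fixes w C u v n :: int and tb tc :: "int list"
  defines "b \<equiv> int (length tb)" and "c \<equiv> int (length tc)" and "Q \<equiv> quasi w C u tb v tc"
  shows "Q n - Q (n - 1) - Q (n - b) - Q (n - c) + Q (n - 1 - b) + Q (n - 1 - c)
           + Q (n - b - c) - Q (n - 1 - b - c) = 0"
proof -
  have "tab tc (m - b - c) = tab tc (m - b)" for m
    unfolding c_def by (rule tab_minus_length)
  moreover have "tab tb (m - b - c) = tab tb (m - c)" for m
    using tab_minus_length[of tb "m - c"] unfolding b_def by (simp only: cancel_ab_semigroup_add_class.diff_right_commute[of m c])
  moreover have "tab tb (m - b) = tab tb m" "tab tc (m - c) = tab tc m" for m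
    unfolding b_def c_def by simp_all
  ultimately show ?thesis
    unfolding Q_def quasi_def b_def[symmetric] c_def[symmetric]
    by (simp only:, simp add: algebra_simps)
qed

fun bounded_sums :: "int \<Rightarrow> int \<Rightarrow> int list \<Rightarrow> bool" where
  "bounded_sums B S [] \<longleftrightarrow> S = 0"
| "bounded_sums B S (x # xs) \<longleftrightarrow> \<bar>S\<bar> \<le> B \<and> bounded_sums B (S + x) xs"

lemma bounded_sumsD:
  assumes "bounded_sums B S xs"
  shows "S + sum_list xs = 0"
    and "i < length xs \<Longrightarrow> \<bar>S + sum_list (take i xs)\<bar> \<le> B"
  using assms
proof (induction B S xs arbitrary: i rule: bounded_sums.induct)
  case (2 B S x xs)
  { case 1 thus ?case using 2(1) by simp }
  { case 2 thus ?case using "2.IH"(2)[of "i - 1"] by (cases i) (auto simp: add.assoc) }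
qed auto

text \<open>A period of sum zero makes the prefix sums themselves periodic, so bounding them over
  one period suffices.\<close>

lemma periodic_sum_bound:
  fixes f :: "nat \<Rightarrow> int"
  assumes "\<And>m. f (m + L) = f m" "L > 0" "bounded_sums B 0 (map f [0..<L])"
  shows "\<bar>\<Sum>m<x. f m\<bar> \<le> B"
proof -
  have sum: "(\<Sum>m<i. f m) = sum_list (take i (map f [0..<L]))" if "i \<le> L" for i
    using that by (simp add: take_map interv_sum_list_conv_sum_set_nat atLeast0LessThan)
  have zero: "(\<Sum>m<L. f m) = 0"
    using sum[of L] bounded_sumsD(1)[OF assms(3)] by simp
  have add: "(\<Sum>m<L + x. f m) = (\<Sum>m<x. f m)" for x
    by (induction x) (use assms(1) zero in \<open>simp_all add: add.commute\<close>)
  show ?thesis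
  proof (induction x rule: less_induct)
    case (less x)
    show ?case
    proof (cases "x < L")
      case True
      thus ?thesis using sum[of x] bounded_sumsD(2)[OF assms(3), of x] by simp
    next
      case False
      thus ?thesis using add[of "x - L"] less.IH[of "x - L"] assms(2) by simp
    qed
  qed
qed

text \<open>The drift \<open>\<plusminus>e\<close> is the \<open>(-1)\<^sup>n\<close> component of a table of even length, the only component
  that resonates with the signs \<open>(-1)\<^bsup>tri m\<^esup>\<close>. The definition uses integer arithmetic instead of \<open>tri\<close>
  because unary numbers are slow to evaluate.\<close>
definition osc_term :: "int list \<Rightarrow> int \<Rightarrow> int \<Rightarrow> nat \<Rightarrow> int" where
  "osc_term t e n m = (let T = int m * (int m + 1) div 2
     in (if even T then tab t (n - T) else - tab t (n - T)) - (if even n then e else - e))"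

lemma osc_term_eq:
  "osc_term t e n m = (-1) ^ tri m * tab t (n - int (tri m)) - (if even n then e else - e)"
proof -
  have "int m * (int m + 1) = int (2 * tri m)" unfolding double_tri by (simp add: algebra_simps)
  hence "int m * (int m + 1) div 2 = int (tri m)" by simp
  thus ?thesis by (simp add: osc_term_def Let_def minus_one_power_iff)
qed

text \<open>The period is \<open>4 * length t\<close> because T_(m+4d) - T_m is an even multiple of
  d, which preserves both sign and table entry. Only the residue of \<open>n\<close> matters; with a
  nonzero drift it must also determine the parity of \<open>n\<close>, hence the even
  length.\<close>

definition osc_bounded :: "int list \<Rightarrow> int \<Rightarrow> int \<Rightarrow> bool" where
  "osc_bounded t e B \<longleftrightarrow> t \<noteq> [] \<and> (e = 0 \<or> even (length t)) \<and>
     list_all (\<lambda>j. bounded_sums B 0 (map (osc_term t e (int j)) [0..<4 * length t])) [0..<length t]"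

lemma osc_boundedD:
  assumes "osc_bounded t e B"
  shows "\<bar>(\<Sum>m<x. (-1) ^ tri m * tab t (n - int (tri m))) - (if even n then e else - e) * int x\<bar> \<le> B"
proof -
  define d where "d = length t"
  define j where "j = nat (n mod int d)"
  have d: "d > 0" and e: "e = 0 \<or> even d" using assms by (auto simp: osc_bounded_def d_def)
  have j: "j < d" "int j = n mod int d" using d by (auto simp: j_def nat_less_iff)
  have "even n = even (n mod int d)" if "even d" using that by (simp add: dvd_mod_iff)
  hence eq: "osc_term t e n m = osc_term t e (int j) m" for m
    using e unfolding osc_term_eq j(2) by (auto intro!: arg_cong2[of _ _ _ _ "(*)"] tab_cong simp: d_def mod_simps)
  have "osc_term t e (int j) (m + 4 * d) = osc_term t e (int j) m" for m
  proof -
    have "2 * tri (m + 4 * d) = 2 * (tri m + d * (2 * (2 * m + 4 * d + 1)))"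
      unfolding double_tri distrib_left[of 2 "tri m"] by (simp add: algebra_simps)
    hence tri: "tri (m + 4 * d) = tri m + d * (2 * (2 * m + 4 * d + 1))" by simp
    have "tab t (int j - int (tri (m + 4 * d))) = tab t (int j - int (tri m))"
    proof (rule tab_cong)
      have "int j - int (tri (m + 4 * d)) = int j - int (tri m) - int d * (2 * (2 * m + 4 * d + 1))"
        unfolding tri by (simp add: algebra_simps)
      thus "(int j - int (tri (m + 4 * d))) mod int (length t) = (int j - int (tri m)) mod int (length t)"
        unfolding d_def[symmetric] by (metis mod_diff_right_eq mod_mult_self1_is_0 diff_zero)
    qed
    moreover have "(-1 :: int) ^ tri (m + 4 * d) = (-1) ^ tri m"
      unfolding tri by (simp only: minus_one_power_iff even_add even_mult_iff) simp
    ultimately show ?thesis unfolding osc_term_eq by simp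
  qed
  moreover have "bounded_sums B 0 (map (osc_term t e (int j)) [0..<4 * d])"
    using assms j(1) by (auto simp: osc_bounded_def d_def list_all_iff)
  ultimately have "\<bar>\<Sum>m<x. osc_term t e (int j) m\<bar> \<le> B"
    using d by (intro periodic_sum_bound) auto
  thus ?thesis unfolding eq[symmetric] by (simp add: osc_term_eq sum_subtractf mult.commute)
qed

section \<open>From the quasi-polynomial to nonnegativity\<close>

lemma sum_lessThan_Suc_split:
  fixes f :: "nat \<Rightarrow> 'a :: comm_monoid_add"
  assumes "i \<le> Suc M"
  shows "sum f {..<Suc M} = sum f {..<i} + sum f {i..M}"
proof -
  have "{..<Suc M} = {..<i} \<union> {i..M}" "{..<i} \<inter> {i..M} = {}" using assms by auto
  thus ?thesis by (simp only: sum.union_disjoint finite_lessThan finite_atLeastAtMost)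
qed

lemma sign_tail_bound: "\<bar>\<Sum>m=2*k..M. (-1) ^ tri m :: int\<bar> \<le> 1"
proof -
  have even: "(\<Sum>m<2 * i. (-1) ^ tri m :: int) = 0" for i
  proof (induction i)
    case (Suc i)
    have "{..<2 * Suc i} = insert (2 * i) (insert (2 * i + 1) {..<2 * i})" by auto
    thus ?case using Suc sign_tri_even[of i, where 'a = int] sign_tri_odd[of i, where 'a = int]
      by (simp del: tri.simps)
  qed simp
  have "\<bar>\<Sum>m<x. (-1) ^ tri m :: int\<bar> \<le> 1" for x
  proof (cases "even x")
    case True
    thus ?thesis using even by (elim evenE) simp
  next
    case False
    then obtain i where "x = Suc (2 * i)" by (elim oddE) simp
    thus ?thesis using even[of i] by (simp add: power_abs)
  qed
  moreover have "(\<Sum>m=2*k..M. (-1) ^ tri m :: int) = (\<Sum>m<Suc M. (-1) ^ tri m)" if "2 * k \<le> M"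
  proof -
    from that have "2 * k \<le> Suc M" by simp
    from sum_lessThan_Suc_split[OF this, of "\<lambda>m. (-1) ^ tri m :: int"] show ?thesis using even[of k] by simp
  qed
  ultimately show ?thesis by (cases "2 * k \<le> M") (simp_all del: sum.lessThan_Suc)
qed

text \<open>Completing the square, z (z + s) = (z + s/2)^2 - s^2/4, leaves the constant
  \<open>C - w * s\<^sup>2 / 4\<close> against a sign sum of size at most 1, plus the tables.
  \<open>bound\<close> compares these errors with the surplus of the squares, all times 4 to stay in
  the integers.\<close>

lemma tail_sum_quasi_nonneg:
  fixes w C u v eb ec Bb Bc :: int and tb tc :: "int list" and k n M :: nat
  defines "s \<equiv> 1 + int (length tb) + int (length tc)"
  assumes "w > 0" "u \<ge> 0" "v \<ge> 0" "s \<le> 13"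
    and osc: "osc_bounded tb eb Bb" "osc_bounded tc ec Bc"
    and M: "22 \<le> M" "tri M \<le> n" "n < tri (Suc M)"
    and k: "1 \<le> k" "2 * k + 2 \<le> M"
    and bound: "\<bar>4 * C - w * s\<^sup>2\<bar> + 8 * (u * Bb + v * Bc) + 4 * \<bar>u * eb + v * ec\<bar> * (int M - 1)
       \<le> w * ((int M)\<^sup>2 + 2 * int M - 8)"
  shows "0 \<le> tail_sum (\<lambda>i. quasi w C u tb v tc (int i)) k n"
proof -
  define y where "y = real n + s / 2"
  define g where "g = (\<lambda>m. (-1) ^ tri m * (u * tab tb (int n - int (tri m)) + v * tab tc (int n - int (tri m))))"
  define \<delta> where "\<delta> = (if even n then u * eb + v * ec else - (u * eb + v * ec))"
  define R where "R = (\<Sum>m=2*k..M. g m)"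
  define c where "c = (\<Sum>m=2*k..M. (-1) ^ tri m :: int)"
  have drift: "\<bar>sum g {..<x} - \<delta> * x\<bar> \<le> u * Bb + v * Bc" for x
  proof -
    let ?S = "\<lambda>t e. (\<Sum>m<x. (-1) ^ tri m * tab t (int n - int (tri m)))
      - (if even (int n) then e else - e) * int x"
    have "\<bar>sum g {..<x} - \<delta> * x\<bar> = \<bar>u * ?S tb eb + v * ?S tc ec\<bar>"
      unfolding g_def \<delta>_def by (simp add: sum.distrib sum_distrib_left algebra_simps)
    also have "\<dots> \<le> u * \<bar>?S tb eb\<bar> + v * \<bar>?S tc ec\<bar>"
      using assms by (intro order_trans[OF abs_triangle_ineq]) (simp add: abs_mult)
    also have "\<dots> \<le> u * Bb + v * Bc"
      using assms osc_boundedD by (intro add_mono mult_left_mono) blast+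
    finally show ?thesis .
  qed
  \<comment> \<open>As a difference of two prefix sums, \<open>R\<close> doubles the bounded part,
    while its drift covers only \<open>M + 1 - 2 * k \<le> M - 1\<close> indices.\<close>
  have "sum g {..<Suc M} = sum g {..<2 * k} + R"
    unfolding R_def using k by (intro sum_lessThan_Suc_split) simp
  hence "\<bar>R - \<delta> * (int M + 1 - 2 * int k)\<bar> \<le> 2 * (u * Bb + v * Bc)"
    using drift[of "Suc M"] drift[of "2 * k"] by (simp add: algebra_simps)
  moreover have "\<bar>\<delta> * (int M + 1 - 2 * int k)\<bar> \<le> \<bar>u * eb + v * ec\<bar> * (int M - 1)"
    using k unfolding abs_mult \<delta>_def by (intro mult_mono) auto
  ultimately have R: "4 * \<bar>R\<bar> \<le> 8 * (u * Bb + v * Bc) + 4 * \<bar>u * eb + v * ec\<bar> * (int M - 1)" by linarith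
  have "\<bar>(4 * C - w * s\<^sup>2) * c\<bar> \<le> \<bar>4 * C - w * s\<^sup>2\<bar> * 1"
    unfolding abs_mult c_def by (intro mult_left_mono sign_tail_bound) simp
  from add_mono[OF this R] bound
  have "\<bar>(4 * C - w * s\<^sup>2) * c\<bar> + 4 * \<bar>R\<bar> \<le> w * ((int M)\<^sup>2 + 2 * int M - 8)"
    unfolding mult_1_right add.assoc by (rule order_trans)
  hence "of_int (\<bar>(4 * C - w * s\<^sup>2) * c\<bar> + 4 * \<bar>R\<bar>) \<le> (of_int (w * ((int M)\<^sup>2 + 2 * int M - 8)) :: real)"
    by (simp only: of_int_le_iff)
  moreover have "(C - w * s\<^sup>2 / 4) * c = real_of_int ((4 * C - w * s\<^sup>2) * c) / 4"
    by (simp add: field_simps)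
  hence scaled: "\<bar>(C - w * s\<^sup>2 / 4) * c\<bar> = real_of_int \<bar>(4 * C - w * s\<^sup>2) * c\<bar> / 4"
    by (simp only: abs_divide of_int_abs abs_numeral)
  ultimately have err: "\<bar>(C - w * s\<^sup>2 / 4) * c\<bar> + \<bar>real_of_int R\<bar> \<le> w * ((real M)\<^sup>2 / 4 + M / 2 - 2)"
    unfolding scaled by (simp add: field_simps)
  let ?main = "\<Sum>m=2*k..M. (-1) ^ (k + tri m) * (y - tri m)\<^sup>2"
  have "real_of_int (tail_sum (\<lambda>i. quasi w C u tb v tc (int i)) k n)
      = (\<Sum>m=2*k..M. (-1) ^ (k + tri m) * real_of_int (quasi w C u tb v tc (int (n - tri m))))"
    unfolding tail_sum_bracket[OF M(2,3)] by simp
  also have "\<dots> = (\<Sum>m=2*k..M. w * ((-1) ^ (k + tri m) * (y - tri m)\<^sup>2)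
      + (-1) ^ k * ((C - w * s\<^sup>2 / 4) * (-1) ^ tri m + g m))"
  proof (intro sum.cong refl)
    fix m assume "m \<in> {2*k..M}"
    hence "tri m \<le> n" using tri_le_bracket[OF M(2,3)] by simp
    hence "int (n - tri m) = int n - int (tri m)" by simp
    moreover have "quasi w C u tb v tc z = w * (z * (z + s)) + C + u * tab tb z + v * tab tc z" for z
      by (simp add: quasi_def s_def add.assoc)
    ultimately show "(-1) ^ (k + tri m) * real_of_int (quasi w C u tb v tc (int (n - tri m))) =
      w * ((-1) ^ (k + tri m) * (y - tri m)\<^sup>2) + (-1) ^ k * ((C - w * s\<^sup>2 / 4) * (-1) ^ tri m + g m)"
      unfolding g_def y_def by (simp add: power_add power2_eq_square field_simps)
  qed
  also have "\<dots> = w * ?main + (-1) ^ k * ((C - w * s\<^sup>2 / 4) * c + R)"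
    by (simp only: c_def R_def sum.distrib sum_distrib_left[symmetric]
          of_int_sum of_int_power of_int_minus of_int_1)
  also have "\<dots> \<ge> 0"
  proof -
    have "\<bar>(-1) ^ k * ((C - w * s\<^sup>2 / 4) * c + R)\<bar> = \<bar>(C - w * s\<^sup>2 / 4) * c + R\<bar>"
      unfolding abs_mult[of "(-1) ^ k"] by (simp add: power_abs)
    also have "\<dots> \<le> w * ((real M)\<^sup>2 / 4 + M / 2 - 2)" using err by linarith
    also have "\<dots> \<le> w * ?main"
      unfolding y_def using assms by (intro mult_left_mono alternating_square_tail_bound) auto
    finally show ?thesis by linarith
  qed
  finally show ?thesis by simp
qed

text \<open>\<open>bound\<close> is the error estimate at \<open>M = 2 * K + 2\<close>, and
  \<open>slope\<close> carries it to all larger \<open>M\<close>. Below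
  \<open>tri (2 * Suc K)\<close> evaluation decides, and below \<open>tri (2 * Suc k)\<close>
  monotonicity.\<close>

lemma gamma_coeff_nonneg:
  fixes w C u v eb ec Bb Bc W :: int and tb tc :: "int list" and k K n :: nat
  defines "s \<equiv> 1 + int (length tb) + int (length tc)" and "Q \<equiv> quasi w C u tb v tc"
  assumes "w > 0" "u \<ge> 0" "v \<ge> 0" "s \<le> 13"
    and W: "W > 0" "Q 0 = W" "list_all (\<lambda>i. Q i = 0) [- int (length tb + length tc)..-1]"
    and osc: "osc_bounded tb eb Bb" "osc_bounded tc ec Bc"
    and bound: "\<bar>4 * C - w * s\<^sup>2\<bar> + 8 * (u * Bb + v * Bc) + 4 * \<bar>u * eb + v * ec\<bar> * (2 * int K + 1)
         \<le> w * ((2 * int K + 2)\<^sup>2 + 2 * (2 * int K + 2) - 8)"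
    and slope: "4 * \<bar>u * eb + v * ec\<bar> \<le> w * (2 * int K + 4)"
    and K: "10 \<le> K"
    and rows: "rows_nonneg (map Q [0..int (tri (2 * Suc K)) - 1]) K []"
    and "1 \<le> k"
  shows "0 \<le> gamma_coeff 1 (length tb) (length tc) 2 1 (int k) n"
proof -
  let ?f = "1 / ((1 - fps_X) * (1 - fps_X ^ length tb) * (1 - fps_X ^ length tc)) :: real fps"
  define q where "q = (\<lambda>i. Q (int i))"
  have len: "length tb > 0" "length tc > 0" using osc by (auto simp: osc_bounded_def)
  have f: "fps_nth ?f i = real_of_int (q i) / real_of_int W" for i
    unfolding q_def
  proof (rule fps_nth_recip3)
    fix i :: int
    show "real_of_int (Q i) / W - real_of_int (Q (i - 1)) / W - real_of_int (Q (i - int (length tb))) / W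
      - real_of_int (Q (i - int (length tc))) / W + real_of_int (Q (i - 1 - int (length tb))) / W
      + real_of_int (Q (i - 1 - int (length tc))) / W
      + real_of_int (Q (i - int (length tb) - int (length tc))) / W
      - real_of_int (Q (i - 1 - int (length tb) - int (length tc))) / W = 0"
      using quasi_rec[of w C u tb v tc i, folded Q_def]
      unfolding diff_divide_distrib[symmetric] add_divide_distrib[symmetric]
        of_int_diff[symmetric] of_int_add[symmetric] by simp
  qed (use W len in \<open>auto simp: list_all_iff\<close>)
  have gamma: "gamma_coeff 1 (length tb) (length tc) 2 1 (int k) n = tail_sum (fps_nth ?f) k n"
    unfolding gamma_coeff_eq tail_sum_def by simp
  also have "\<dots> = real_of_int (tail_sum q k n) / W"
    unfolding tail_sum_def f by (simp add: sum_divide_distrib)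
  finally have gamma_q: "gamma_coeff 1 (length tb) (length tc) 2 1 (int k) n = real_of_int (tail_sum q k n) / W" .
  obtain M where M: "tri M \<le> n" "n < tri (Suc M)" using ex_tri_bracket by blast
  consider "n < tri (2 * Suc K)" | "n < tri (2 * Suc k)" | "tri (2 * Suc K) \<le> n" "tri (2 * Suc k) \<le> n"
    by linarith
  thus ?thesis
  proof cases
    case 1
    have "map Q [0..int (tri (2 * Suc K)) - 1] = map q [0..<tri (2 * Suc K)]"
      by (rule nth_equalityI) (simp_all add: q_def nth_upto del: tri.simps)
    hence checked: "rows_nonneg (map q [0..<tri (2 * Suc K)]) K []" using rows by simp
    have "0 \<le> tail_sum q k n"
    proof (cases "k \<le> K")
      case True
      show ?thesis by (rule rows_nonnegD[of q "tri (2 * Suc K)" K]) (use checked 1 True assms in auto)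
    next
      case False
      have "tri (2 * Suc K) \<le> tri (2 * k)" unfolding tri_le_iff using False by simp
      thus ?thesis using 1 tail_sum_eq_0[of n k q] by simp
    qed
    thus ?thesis unfolding gamma_q using W by simp
  next
    case 2
    thus ?thesis unfolding gamma using len
      by (intro tail_sum_nonneg_of_mono fps_nth_recip3_mono)
  next
    case 3
    have "2 * Suc K \<le> M" "2 * Suc k \<le> M" using 3 tri_le_bracket[OF M] by blast+
    define e where "e = \<bar>u * eb + v * ec\<bar>"
    \<comment> \<open>This is the growth of surplus minus drift from \<open>2 * K + 2\<close> to
      \<open>M\<close>.\<close>
    have "0 \<le> (int M - (2 * int K + 2)) * (w * (2 * int K + 4) - 4 * e + w * int M)"
      using \<open>2 * Suc K \<le> M\<close> slope assms(3) unfolding e_def[symmetric]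
      by (intro mult_nonneg_nonneg add_nonneg_nonneg) auto
    hence "\<bar>4 * C - w * s\<^sup>2\<bar> + 8 * (u * Bb + v * Bc) + 4 * \<bar>u * eb + v * ec\<bar> * (int M - 1)
        \<le> w * ((int M)\<^sup>2 + 2 * int M - 8)"
      using bound unfolding e_def[symmetric] by (simp add: power2_eq_square algebra_simps)
    hence "0 \<le> tail_sum q k n"
      using \<open>2 * Suc K \<le> M\<close> \<open>2 * Suc k \<le> M\<close> unfolding q_def Q_def using assms M
      by (intro tail_sum_quasi_nonneg[where M = M and eb = eb and ec = ec and Bb = Bb and Bc = Bc]) auto
    thus ?thesis unfolding gamma_q using W by simp
  qed
qed

subsection \<open>The four triples\<close>

text \<open>Here and in the next three lemmas the range ends at T_(2K+2) - 1, with K = 10, 10, 12,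
  14.\<close>

lemma rows_nonneg_3_4:
  "rows_nonneg (map (quasi 6 83 16 [1, 1, -2] 9 [5, -1, -3, -1]) [0..252]) 10 []"
  by code_simp

lemma rows_nonneg_3_5:
  "rows_nonneg (map (quasi 3 52 10 [2, -1, -1] 18 [1, 1, -1, 0, -1]) [0..252]) 10 []"
  by code_simp

lemma rows_nonneg_4_5:
  "rows_nonneg (map (quasi 2 43 5 [1, 3, 1, -5] 16 [2, 0, -1, -1, 0]) [0..350]) 12 []"
  by code_simp

lemma rows_nonneg_5_7:
  "rows_nonneg (map (quasi 1 36 14 [1, 0, 1, -1, -1] 10 [2, 2, -1, 0, -2, 0, -1]) [0..464]) 14 []"
  by code_simp

lemma gamma_coeff_nonneg_3_4:
  assumes "1 \<le> k"
  shows "0 \<le> gamma_coeff 1 3 4 2 1 (int k) n"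
proof -
  have "0 \<le> gamma_coeff 1 (length ([1, 1, -2] :: int list)) (length ([5, -1, -3, -1] :: int list)) 2 1 (int k) n"
  \<comment> \<open>\<open>W\<close> is 2bcw, since the partition count has leading term n^2/(2bc).
    \<open>ec\<close> is the alternating mean (5 + 1 - 3 + 1)/4 of the table.\<close>
  proof (rule gamma_coeff_nonneg[where w = 6 and C = 83 and u = 16 and v = 9
        and eb = 0 and Bb = 3 and ec = 1 and Bc = 4 and W = 144 and K = 10])
    show "osc_bounded [1, 1, -2] 0 3" by code_simp
    show "osc_bounded [5, -1, -3, -1] 1 4" by code_simp
    show "quasi 6 83 16 [1, 1, -2] 9 [5, -1, -3, -1] 0 = 144" by code_simp
    show "list_all (\<lambda>i. quasi 6 83 16 [1, 1, -2] 9 [5, -1, -3, -1] i = 0)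
        [- int (length ([1, 1, -2] :: int list) + length ([5, -1, -3, -1] :: int list))..-1]" by code_simp
    show "rows_nonneg (map (quasi 6 83 16 [1, 1, -2] 9 [5, -1, -3, -1]) [0..int (tri (2 * Suc 10)) - 1]) 10 []"
      using rows_nonneg_3_4 unfolding tri_even by simp
  qed (use assms in \<open>simp_all add: power2_eq_square\<close>)
  thus ?thesis by (simp add: eval_nat_numeral)
qed

lemma gamma_coeff_nonneg_3_5:
  assumes "1 \<le> k"
  shows "0 \<le> gamma_coeff 1 3 5 2 1 (int k) n"
proof -
  have "0 \<le> gamma_coeff 1 (length ([2, -1, -1] :: int list)) (length ([1, 1, -1, 0, -1] :: int list)) 2 1 (int k) n"
  proof (rule gamma_coeff_nonneg[where w = 3 and C = 52 and u = 10 and v = 18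
        and eb = 0 and Bb = 3 and ec = 0 and Bc = 3 and W = 90 and K = 10])
    show "osc_bounded [2, -1, -1] 0 3" by code_simp
    show "osc_bounded [1, 1, -1, 0, -1] 0 3" by code_simp
    show "quasi 3 52 10 [2, -1, -1] 18 [1, 1, -1, 0, -1] 0 = 90" by code_simp
    show "list_all (\<lambda>i. quasi 3 52 10 [2, -1, -1] 18 [1, 1, -1, 0, -1] i = 0)
        [- int (length ([2, -1, -1] :: int list) + length ([1, 1, -1, 0, -1] :: int list))..-1]" by code_simp
    show "rows_nonneg (map (quasi 3 52 10 [2, -1, -1] 18 [1, 1, -1, 0, -1]) [0..int (tri (2 * Suc 10)) - 1]) 10 []"
      using rows_nonneg_3_5 unfolding tri_even by simp
  qed (use assms in \<open>simp_all add: power2_eq_square\<close>)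
  thus ?thesis by (simp add: eval_nat_numeral)
qed

lemma gamma_coeff_nonneg_4_5:
  assumes "1 \<le> k"
  shows "0 \<le> gamma_coeff 1 4 5 2 1 (int k) n"
proof -
  have "0 \<le> gamma_coeff 1 (length ([1, 3, 1, -5] :: int list)) (length ([2, 0, -1, -1, 0] :: int list)) 2 1 (int k) n"
  \<comment> \<open>\<open>eb\<close> is the alternating mean (1 - 3 + 1 + 5)/4, and 12 is the least
    \<open>K\<close> that satisfies \<open>bound\<close>.\<close>
  proof (rule gamma_coeff_nonneg[where w = 2 and C = 43 and u = 5 and v = 16
        and eb = 1 and Bb = 4 and ec = 0 and Bc = 5 and W = 80 and K = 12])
    show "osc_bounded [1, 3, 1, -5] 1 4" by code_simp
    show "osc_bounded [2, 0, -1, -1, 0] 0 5" by code_simp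
    show "quasi 2 43 5 [1, 3, 1, -5] 16 [2, 0, -1, -1, 0] 0 = 80" by code_simp
    show "list_all (\<lambda>i. quasi 2 43 5 [1, 3, 1, -5] 16 [2, 0, -1, -1, 0] i = 0)
        [- int (length ([1, 3, 1, -5] :: int list) + length ([2, 0, -1, -1, 0] :: int list))..-1]" by code_simp
    show "rows_nonneg (map (quasi 2 43 5 [1, 3, 1, -5] 16 [2, 0, -1, -1, 0]) [0..int (tri (2 * Suc 12)) - 1]) 12 []"
      using rows_nonneg_4_5 unfolding tri_even by simp
  qed (use assms in \<open>simp_all add: power2_eq_square\<close>)
  thus ?thesis by (simp add: eval_nat_numeral)
qed

lemma gamma_coeff_nonneg_5_7:
  assumes "1 \<le> k"
  shows "0 \<le> gamma_coeff 1 5 7 2 1 (int k) n"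
proof -
  have "0 \<le> gamma_coeff 1 (length ([1, 0, 1, -1, -1] :: int list)) (length ([2, 2, -1, 0, -2, 0, -1] :: int list)) 2 1 (int k) n"
  proof (rule gamma_coeff_nonneg[where w = 1 and C = 36 and u = 14 and v = 10
        and eb = 0 and Bb = 3 and ec = 0 and Bc = 7 and W = 70 and K = 14])
    show "osc_bounded [1, 0, 1, -1, -1] 0 3" by code_simp
    show "osc_bounded [2, 2, -1, 0, -2, 0, -1] 0 7" by code_simp
    show "quasi 1 36 14 [1, 0, 1, -1, -1] 10 [2, 2, -1, 0, -2, 0, -1] 0 = 70" by code_simp
    show "list_all (\<lambda>i. quasi 1 36 14 [1, 0, 1, -1, -1] 10 [2, 2, -1, 0, -2, 0, -1] i = 0)
        [- int (length ([1, 0, 1, -1, -1] :: int list) + length ([2, 2, -1, 0, -2, 0, -1] :: int list))..-1]" by code_simp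
    show "rows_nonneg (map (quasi 1 36 14 [1, 0, 1, -1, -1] 10 [2, 2, -1, 0, -2, 0, -1]) [0..int (tri (2 * Suc 14)) - 1]) 14 []"
      using rows_nonneg_5_7 unfolding tri_even by simp
  qed (use assms in \<open>simp_all add: power2_eq_square\<close>)
  thus ?thesis by (simp add: eval_nat_numeral)
qed

theorem corollary2p5:
  fixes k :: int and n a b c :: nat
  assumes "k \<ge> 1"
    and "(a, b, c) \<in> {(1, 3, 4), (1, 3, 5), (1, 4, 5), (1, 5, 7)}"
  shows "gamma_coeff a b c 2 1 k n \<ge> 0"
proof -
  obtain i where k: "k = int i" "1 \<le> i"
    using assms(1) by (intro that[of "nat k"]) auto
  show ?thesis
    using assms(2) gamma_coeff_nonneg_3_4[OF k(2)] gamma_coeff_nonneg_3_5[OF k(2)]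
      gamma_coeff_nonneg_4_5[OF k(2)] gamma_coeff_nonneg_5_7[OF k(2)]
    unfolding k(1) by auto
qed

end
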